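(* Let $Q\subseteq\mathbb{R}^n$ be closed and convex, let $d$ be a convex differentiable prox-function with Bregman divergence $V$, and let $g:Q\to\mathbb{R}^n$ be relatively $\mu$-strongly monotone with $\mu>0$ and relatively $L$-smooth with $L>0$ (both with respect to $V$). Let $z_*\in Q$ be an exact solution of the variational inequality $\max_{x\in Q}\langle g(x), z_*-x\rangle\leq 0$. Let $L_0>0$ and let $(z_k)_{k\ge 0}$, $(w_k)_{k\ge0}$, $(L_k)_{k\ge 0}$ be generated by the adaptive method described in the context. Then for every $k\geq 0$ $$V(z_*, z_{k+1}) \leq \prod_{i=0}^{k}\left(1+\frac{\mu}{L_{i+1}}\right)^{-1} V(z_*, z_0).$$ If, in addition, $L_0\leq 2L$, then for every $k\geq 0$ $$V(z_*, z_{k+1}) \leq \left(1+\frac{\mu}{2L}\right)^{-(k+1)} V(z_*, z_0).$$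
   Context: Setting. $Q\subseteq\mathbb{R}^n$ is a closed convex set and $g:Q\to\mathbb{R}^n$ is an operator. $d$ is a convex (in general not strongly convex) differentiable function on $Q$, called the prox-function, and the corresponding Bregman divergence is $$V(y,x):=d(y)-d(x)-\langle\nabla d(x),y-x\rangle .$$ A solution (weak solution) of the variational inequality is a point $z_*\in Q$ with $\langle g(x),z_*-x\rangle\leq 0$ for all $x\in Q$; such a solution is assumed to exist. Relative strong monotonicity: $g$ is relatively $\mu$-strongly monotone ($\mu>0$) if for all $x,y\in Q$ $$\mu V(y,x)+\mu V(x,y)\leq\langle g(y)-g(x),y-x\rangle .$$ Relative smoothness: $g$ is relatively $L$-smooth if for all $x,y,z\in Q$ $$\langle g(y)-g(z),x-z\rangle\leq L V(x,z)+L V(z,y).$$ Adaptive method. Input: $L_0>0$, $\mu>0$, $d$, $V$. Set $z_0=\arg\min_{u\in Q} d(u)$. For each $k=0,1,2,\dots$ find the smallest integer $i_k\geq 0$ such that, with $L_{k+1}=2^{i_k-1}L_k$ and $$w_k=\arg\min_{y\in Q}\left\{\left\langle\tfrac{1}{L_{k+1}}g(z_k),y\right\rangle+V(y,z_k)\right\},$$ $$z_{k+1}=\arg\min_{z\in Q}\left\{\left\langle\tfrac{1}{L_{k+1}}g(w_k),z\right\rangle+V(z,z_k)+\tfrac{\mu}{L_{k+1}}V(z,w_k)\right\},$$ the inequality $$\langle g(z_k)-g(w_k),z_{k+1}-w_k\rangle\leq L_{k+1}\left(V(w_k,z_k)+V(z_{k+1},w_k)\right)$$ holds. The values $L_{k+1},w_k,z_{k+1}$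 for this $i_k$ are the ones used. Here $\arg\min$ denotes a minimizer; all minimizers in the method (including those for trial values of $i_k$) are assumed to exist. *)

theory Defs
  imports "HOL-Analysis.Analysis"
begin

text \<open>
  The prox-function \<open>d\<close> is only required to be differentiable on \<open>Q\<close>, hence the derivative
  within \<open>Q\<close>.  If \<open>Q\<close> has empty interior this does not determine \<open>nd x\<close>, but it does
  determine the products \<open>nd x \<bullet> (y - x)\<close> for \<open>x\<close>, \<open>y\<close> in \<open>Q\<close>, which are all that enters the
  Bregman divergence on \<open>Q\<close>.
\<close>

definition prox_function ::
  "'a::real_inner set \<Rightarrow> ('a \<Rightarrow> real) \<Rightarrow> ('a \<Rightarrow> 'a) \<Rightarrow> bool" where
  "prox_function Q d nd \<longleftrightarrow>
     convex_on Q d \<and> (\<forall>x\<in>Q. (d has_derivative (\<lambda>h. nd x \<bullet> h)) (at x within Q))"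

definition bregman ::
  "('a::real_inner \<Rightarrow> real) \<Rightarrow> ('a \<Rightarrow> 'a) \<Rightarrow> 'a \<Rightarrow> 'a \<Rightarrow> real" where
  "bregman d nd y x = d y - d x - nd x \<bullet> (y - x)"

definition rel_strongly_monotone ::
  "'a::real_inner set \<Rightarrow> ('a \<Rightarrow> 'a \<Rightarrow> real) \<Rightarrow> real \<Rightarrow> ('a \<Rightarrow> 'a) \<Rightarrow> bool" where
  "rel_strongly_monotone Q V \<mu> g \<longleftrightarrow>
     (\<forall>x\<in>Q. \<forall>y\<in>Q. \<mu> * V y x + \<mu> * V x y \<le> (g y - g x) \<bullet> (y - x))"

definition rel_smooth ::
  "'a::real_inner set \<Rightarrow> ('a \<Rightarrow> 'a \<Rightarrow> real) \<Rightarrow> real \<Rightarrow> ('a \<Rightarrow> 'a) \<Rightarrow> bool" where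
  "rel_smooth Q V L g \<longleftrightarrow>
     (\<forall>x\<in>Q. \<forall>y\<in>Q. \<forall>z\<in>Q. (g y - g z) \<bullet> (x - z) \<le> L * V x z + L * V z y)"

definition vi_weak_solution ::
  "'a::real_inner set \<Rightarrow> ('a \<Rightarrow> 'a) \<Rightarrow> 'a \<Rightarrow> bool" where
  "vi_weak_solution Q g zs \<longleftrightarrow> zs \<in> Q \<and> (\<forall>x\<in>Q. g x \<bullet> (zs - x) \<le> 0)"

text \<open>
  \<open>M\<close> is the trial value of \<open>L\<^sub>k\<^sub>+\<^sub>1\<close> and \<open>z\<close> the current iterate \<open>z\<^sub>k\<close>; \<open>w\<close> and \<open>z'\<close> are
  the resulting \<open>w\<^sub>k\<close> and \<open>z\<^sub>k\<^sub>+\<^sub>1\<close>.  Minimizers need not be unique.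
\<close>

definition trial_step ::
  "'a::real_inner set \<Rightarrow> ('a \<Rightarrow> 'a \<Rightarrow> real) \<Rightarrow> ('a \<Rightarrow> 'a) \<Rightarrow> real \<Rightarrow> real \<Rightarrow> 'a \<Rightarrow> 'a \<Rightarrow> 'a \<Rightarrow> bool" where
  "trial_step Q V g \<mu> M z w z' \<longleftrightarrow>
     is_arg_min (\<lambda>y. ((1 / M) *\<^sub>R g z) \<bullet> y + V y z) (\<lambda>y. y \<in> Q) w \<and>
     is_arg_min (\<lambda>u. ((1 / M) *\<^sub>R g w) \<bullet> u + V u z + (\<mu> / M) * V u w) (\<lambda>u. u \<in> Q) z'"

definition step_accepted ::
  "('a::real_inner \<Rightarrow> 'a \<Rightarrow> real) \<Rightarrow> ('a \<Rightarrow> 'a) \<Rightarrow> real \<Rightarrow> 'a \<Rightarrow> 'a \<Rightarrow> 'a \<Rightarrow> bool" where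
  "step_accepted V g M z w z' \<longleftrightarrow> (g z - g w) \<bullet> (z' - w) \<le> M * (V w z + V z' w)"

text \<open>
  In iteration \<open>k\<close> the trial with index \<open>j\<close> computes some minimizers \<open>wt j\<close> and \<open>zt j\<close>; the
  accepted index \<open>i\<close> is the smallest one whose computed minimizers pass the test.
  The choice of minimizers is arbitrary, including those of the rejected trials.
\<close>

definition adaptive_method ::
  "'a::real_inner set \<Rightarrow> ('a \<Rightarrow> real) \<Rightarrow> ('a \<Rightarrow> 'a \<Rightarrow> real) \<Rightarrow> ('a \<Rightarrow> 'a) \<Rightarrow> real \<Rightarrow> real \<Rightarrow>
   (nat \<Rightarrow> 'a) \<Rightarrow> (nat \<Rightarrow> 'a) \<Rightarrow> (nat \<Rightarrow> real) \<Rightarrow> bool" where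
  "adaptive_method Q d V g \<mu> L0 z w Ls \<longleftrightarrow>
     is_arg_min d (\<lambda>u. u \<in> Q) (z 0) \<and> Ls 0 = L0 \<and>
     (\<forall>k. \<exists>i wt zt.
        (\<forall>j\<le>i. trial_step Q V g \<mu> (2 powi (int j - 1) * Ls k) (z k) (wt j) (zt j)) \<and>
        step_accepted V g (2 powi (int i - 1) * Ls k) (z k) (wt i) (zt i) \<and>
        (\<forall>j<i. \<not> step_accepted V g (2 powi (int j - 1) * Ls k) (z k) (wt j) (zt j)) \<and>
        Ls (Suc k) = 2 powi (int i - 1) * Ls k \<and> w k = wt i \<and> z (Suc k) = zt i)"

end

theory Submission
  imports Defs
begin

text \<open>
  One step of the method is analysed as for any extragradient scheme. The optimality conditions
  of the two subproblems, rewritten by the three-point identity of the Bregman divergence, are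
  tested at \<open>z'\<close> and at the solution \<open>zs\<close> respectively and added; the acceptance test
  absorbs the cross term \<open>(g z - g w) \<bullet> (z' - w)\<close> exactly. What is left is
  \<open>g w \<bullet> (w - zs) \<le> M * V zs z - (M + \<mu>) * V zs z' + \<mu> * V zs w\<close> up to a nonpositive term, so
  that the contraction \<open>(1 + \<mu> / M) * V zs z' \<le> V zs z\<close> follows from
  \<open>\<mu> * V zs w \<le> g w \<bullet> (w - zs)\<close>.

  Strong monotonicity yields this last bound provided that \<open>g zs \<bullet> (w - zs) \<ge> 0\<close>, that is, provided
  that \<open>zs\<close> is a strong (Stampacchia) solution, whereas only \<open>g x \<bullet> (zs - x) \<le> 0\<close> is given.
  Minty's argument bridges the gap, with relative smoothness in the role of continuity of \<open>g\<close>: it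
  controls the variation of \<open>g\<close> along the segment from \<open>zs\<close> to \<open>x\<close> by Bregman divergences, and
  these are of smaller order than the distance to \<open>zs\<close> (lemma \<open>weak_solution_imp_strong\<close>).

  For the explicit rate, relative smoothness makes every trial with parameter at least \<open>L\<close> pass.
  A step that was preceded by a rejected trial therefore uses less than \<open>2 * L\<close>, and a step that was
  not halves the previous parameter, so the bound \<open>2 * L\<close> persists.

  Everything about \<open>d\<close> that involves a limit is reduced to one fact, that
  \<open>V (x + t *\<^sub>R (y - x)) x\<close> is \<open>o(t)\<close> as \<open>t\<close> decreases to \<open>0\<close>.
\<close>

lemma bregman_three_points:
  "bregman d nd u x - bregman d nd u p - bregman d nd p x = (nd p - nd x) \<bullet> (u - p)"
  unfolding bregman_def by (simp add: inner_diff_left inner_diff_right)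

lemma segment_mem:
  assumes "convex Q" "x \<in> Q" "y \<in> Q" "0 \<le> t" "t \<le> 1"
  shows "x + t *\<^sub>R (y - x) \<in> Q"
proof -
  have "x + t *\<^sub>R (y - x) = (1 - t) *\<^sub>R x + t *\<^sub>R y"
    by (simp add: algebra_simps)
  then show ?thesis
    using assms by (simp add: convex_alt)
qed

lemma bregman_segment_little_o:
  fixes Q :: "'a::real_inner set"
  assumes "convex Q" "prox_function Q d nd" "x \<in> Q" "y \<in> Q"
  shows "((\<lambda>t. bregman d nd (x + t *\<^sub>R (y - x)) x / t) \<longlongrightarrow> 0) (at_right 0)"
proof -
  define c where "c t = x + t *\<^sub>R (y - x)" for t
  have dQ: "(d has_derivative (\<lambda>h. nd x \<bullet> h)) (at (c 0) within c ` {0..1})"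
  proof (rule has_derivative_subset)
    show "(d has_derivative (\<lambda>h. nd x \<bullet> h)) (at (c 0) within Q)"
      using assms by (simp add: prox_function_def c_def)
    show "c ` {0..1} \<subseteq> Q"
      using segment_mem[OF assms(1,3,4)] by (auto simp: c_def)
  qed
  have "(c has_derivative (\<lambda>t. t *\<^sub>R (y - x))) (at 0 within {0..1})"
    unfolding c_def by (auto intro!: derivative_eq_intros)
  from has_derivative_in_compose[OF this dQ]
  have "((\<lambda>t. d (c t)) has_field_derivative nd x \<bullet> (y - x)) (at 0 within {0..1})"
    by (simp add: has_field_derivative_def mult.commute[of _ "nd x \<bullet> (y - x)"])
  then have "((\<lambda>t. (d (c t) - d x) / t) \<longlongrightarrow> nd x \<bullet> (y - x)) (at 0 within {0..1})"
    by (simp add: has_field_derivative_iff c_def)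
  then have "((\<lambda>t. (d (c t) - d x) / t) \<longlongrightarrow> nd x \<bullet> (y - x)) (at_right 0)"
    by (simp add: at_within_Icc_at_right)
  then have "((\<lambda>t. (d (c t) - d x) / t - nd x \<bullet> (y - x)) \<longlongrightarrow> 0) (at_right 0)"
    by (rule LIM_zero)
  moreover have "\<forall>\<^sub>F t in at_right 0.
      (d (c t) - d x) / t - nd x \<bullet> (y - x) = bregman d nd (c t) x / t"
    using eventually_at_right_less[of "0::real"]
    by eventually_elim (simp add: bregman_def c_def divide_simps)
  ultimately show ?thesis
    unfolding c_def by (rule Lim_transform_eventually)
qed

text \<open>
  The divergence from \<open>x\<close> grows at most linearly along a segment, by convexity of \<open>d\<close>, yet it is
  \<open>o(t)\<close> near \<open>x\<close>; so its slope cannot be negative.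
\<close>

lemma bregman_nonneg:
  fixes Q :: "'a::real_inner set"
  assumes "convex Q" "prox_function Q d nd" "x \<in> Q" "y \<in> Q"
  shows "0 \<le> bregman d nd y x"
proof (rule tendsto_upperbound)
  show "((\<lambda>t. bregman d nd (x + t *\<^sub>R (y - x)) x / t) \<longlongrightarrow> 0) (at_right 0)"
    by (rule bregman_segment_little_o[OF assms])
  have cd: "convex_on Q d"
    using assms by (simp add: prox_function_def)
  show "\<forall>\<^sub>F t in at_right 0. bregman d nd (x + t *\<^sub>R (y - x)) x / t \<le> bregman d nd y x"
    using eventually_at_right_less[of "0::real"] eventually_at_right_real[OF zero_less_one]
  proof eventually_elim
    case (elim t)
    have "d ((1 - t) *\<^sub>R x + t *\<^sub>R y) \<le> (1 - t) * d x + t * d y"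
      using elim assms by (intro convex_onD[OF cd]) auto
    moreover have "(1 - t) *\<^sub>R x + t *\<^sub>R y = x + t *\<^sub>R (y - x)"
      by (simp add: algebra_simps)
    ultimately have "bregman d nd (x + t *\<^sub>R (y - x)) x \<le> t * bregman d nd y x"
      by (simp add: bregman_def algebra_simps)
    then show ?case
      using elim by (simp add: divide_simps mult.commute)
  qed
qed simp

text \<open>
  Moving from \<open>p\<close> towards \<open>u\<close> changes the objective by a linear term plus a multiple of the
  divergence from \<open>p\<close>. The latter is negligible to first order, so the linear term is nonnegative;
  this is the optimality condition, stated here through the three-point identity.
\<close>

lemma bregman_prox_optimality:
  fixes Q :: "'a::real_inner set"
  assumes "convex Q" "prox_function Q d nd"
    and V: "V = bregman d nd"
    and min: "is_arg_min (\<lambda>u. a \<bullet> u + \<alpha> * V u x + \<beta> * V u y) (\<lambda>u. u \<in> Q) p"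
    and u: "u \<in> Q"
  shows "a \<bullet> (p - u) \<le> \<alpha> * (V u x - V u p - V p x) + \<beta> * (V u y - V u p - V p y)"
proof -
  have p: "p \<in> Q"
    using min by (simp add: is_arg_min_def)
  define s where "s = (a + \<alpha> *\<^sub>R (nd p - nd x) + \<beta> *\<^sub>R (nd p - nd y)) \<bullet> (u - p)"
  have lim: "((\<lambda>t. s + (\<alpha> + \<beta>) * (V (p + t *\<^sub>R (u - p)) p / t)) \<longlongrightarrow> s + (\<alpha> + \<beta>) * 0) (at_right 0)"
    unfolding V by (intro tendsto_intros bregman_segment_little_o[OF assms(1,2) p u])
  have "0 \<le> s + (\<alpha> + \<beta>) * 0"
  proof (rule tendsto_lowerbound[OF lim])
    show "\<forall>\<^sub>F t in at_right 0. 0 \<le> s + (\<alpha> + \<beta>) * (V (p + t *\<^sub>R (u - p)) p / t)"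
      using eventually_at_right_less[of "0::real"] eventually_at_right_real[OF zero_less_one]
    proof eventually_elim
      case (elim t)
      define q where "q = p + t *\<^sub>R (u - p)"
      have "q \<in> Q"
        using elim segment_mem[OF assms(1) p u] by (simp add: q_def)
      then have "a \<bullet> p + \<alpha> * V p x + \<beta> * V p y \<le> a \<bullet> q + \<alpha> * V q x + \<beta> * V q y"
        using min by (auto simp: is_arg_min_linorder)
      moreover have "V q x - V q p - V p x = t * ((nd p - nd x) \<bullet> (u - p))"
        "V q y - V q p - V p y = t * ((nd p - nd y) \<bullet> (u - p))"
        unfolding V bregman_three_points by (simp_all add: q_def)
      then have "V q x = V p x + V q p + t * ((nd p - nd x) \<bullet> (u - p))"
        "V q y = V p y + V q p + t * ((nd p - nd y) \<bullet> (u - p))"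
        by simp_all
      moreover have "a \<bullet> q = a \<bullet> p + t * (a \<bullet> (u - p))"
        by (simp add: q_def inner_add_right)
      ultimately have "0 \<le> t * s + (\<alpha> + \<beta>) * V q p"
        unfolding s_def by (simp only: inner_add_left inner_scaleR_left) (simp add: algebra_simps)
      then have "0 \<le> (t * s + (\<alpha> + \<beta>) * V q p) / t"
        using elim by simp
      then show ?case
        using elim by (simp add: q_def add_divide_distrib)
    qed
  qed simp
  then show ?thesis
    unfolding V bregman_three_points s_def
    by (simp add: inner_add_left inner_diff_right right_diff_distrib)
qed

text \<open>
  Put \<open>c t = zs + t *\<^sub>R (x - zs)\<close>. Relative smoothness at the triple \<open>c t, c t, zs\<close> bounds
  \<open>(g (c t) - g zs) \<bullet> (c t - zs)\<close> by \<open>V (c t) zs + V zs (c t)\<close>, up to the factor \<open>L\<close>. The first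
  term is \<open>o(t)\<close>. So is the second, in which \<open>nd\<close> is evaluated at the moving point \<open>c t\<close>: since
  \<open>c t\<close> is the midpoint of \<open>zs\<close> and \<open>c (2 * t)\<close>, the gradients cancel in
  \<open>V zs (c t) + V (c (2 * t)) (c t) = V (c (2 * t)) zs - 2 * V (c t) zs\<close>, and
  \<open>V (c (2 * t)) (c t)\<close> is nonnegative.
\<close>

lemma weak_solution_imp_strong:
  fixes Q :: "'a::real_inner set"
  assumes "convex Q" "prox_function Q d nd"
    and V: "V = bregman d nd"
    and "0 \<le> L" and smooth: "rel_smooth Q V L g"
    and sol: "vi_weak_solution Q g zs"
    and x: "x \<in> Q"
  shows "0 \<le> g zs \<bullet> (x - zs)"
proof -
  have zs: "zs \<in> Q"
    using sol by (simp add: vi_weak_solution_def)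
  define c where "c t = zs + t *\<^sub>R (x - zs)" for t
  have o1: "((\<lambda>t. V (c t) zs / t) \<longlongrightarrow> 0) (at_right 0)"
    unfolding V c_def by (rule bregman_segment_little_o[OF assms(1,2) zs x])
  have "filterlim (\<lambda>t::real. 2 * t) (at_right 0) (at_right 0)"
    unfolding filterlim_at
    using eventually_at_right_less[of "0::real"]
    by (auto intro!: tendsto_eq_intros elim: eventually_mono)
  from filterlim_compose[OF o1 this]
  have o2: "((\<lambda>t. V (c (2 * t)) zs / (2 * t)) \<longlongrightarrow> 0) (at_right 0)" .
  have lim: "((\<lambda>t. L * (2 * (V (c (2 * t)) zs / (2 * t)) - V (c t) zs / t) + g zs \<bullet> (x - zs))
      \<longlongrightarrow> L * (2 * 0 - 0) + g zs \<bullet> (x - zs)) (at_right 0)"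
    by (intro tendsto_intros o1 o2)
  have "0 \<le> L * (2 * 0 - 0) + g zs \<bullet> (x - zs)"
  proof (rule tendsto_lowerbound[OF lim])
    have half: "(0::real) < 1 / 2"
      by simp
    show "\<forall>\<^sub>F t in at_right 0.
        0 \<le> L * (2 * (V (c (2 * t)) zs / (2 * t)) - V (c t) zs / t) + g zs \<bullet> (x - zs)"
      using eventually_at_right_less[of "0::real"] eventually_at_right_real[OF half]
    proof eventually_elim
      case (elim t)
      have cQ: "c t \<in> Q" "c (2 * t) \<in> Q"
        using elim segment_mem[OF assms(1) zs x] by (auto simp: c_def)
      have "zs - c t = - (t *\<^sub>R (x - zs))" "c t - zs = t *\<^sub>R (x - zs)"
        "c (2 * t) - zs = 2 *\<^sub>R (t *\<^sub>R (x - zs))"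
        by (simp_all add: c_def)
      moreover have "c (2 * t) - c t = t *\<^sub>R (x - zs)"
        unfolding c_def by (simp add: scaleR_2 flip: scaleR_scaleR)
      ultimately have "V zs (c t) + V (c (2 * t)) (c t) = V (c (2 * t)) zs - 2 * V (c t) zs"
        unfolding V bregman_def by simp
      moreover have "0 \<le> V (c (2 * t)) (c t)"
        unfolding V by (rule bregman_nonneg[OF assms(1,2) cQ])
      ultimately have "V (c t) zs + V zs (c t) \<le> V (c (2 * t)) zs - V (c t) zs"
        by simp
      then have "L * (V (c t) zs + V zs (c t)) \<le> L * (V (c (2 * t)) zs - V (c t) zs)"
        using \<open>0 \<le> L\<close> by (rule mult_left_mono)
      moreover have "(g (c t) - g zs) \<bullet> (c t - zs) \<le> L * V (c t) zs + L * V zs (c t)"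
        using smooth cQ zs by (simp add: rel_smooth_def)
      moreover have "g (c t) \<bullet> (zs - c t) \<le> 0"
        using sol cQ by (simp add: vi_weak_solution_def)
      ultimately have "0 \<le> L * (V (c (2 * t)) zs - V (c t) zs) + g zs \<bullet> (c t - zs)"
        by (simp add: inner_diff_left inner_diff_right distrib_left)
      then have "0 \<le> (L * (V (c (2 * t)) zs - V (c t) zs) + t * (g zs \<bullet> (x - zs))) / t"
        using elim by (simp add: c_def)
      also have "\<dots> = L * (2 * (V (c (2 * t)) zs / (2 * t)) - V (c t) zs / t) + g zs \<bullet> (x - zs)"
        using elim by (simp add: field_simps)
      finally show ?case .
    qed
  qed simp
  then show ?thesis
    by simp
qed

lemma trial_step_mem:
  assumes "trial_step Q V g \<mu> M z w z'"
  shows "w \<in> Q" "z' \<in> Q"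
  using assms by (auto simp: trial_step_def is_arg_min_def)

lemma accepted_step_contracts:
  fixes Q :: "'a::real_inner set"
  assumes Q: "convex Q" and d: "prox_function Q d nd"
    and V: "V = bregman d nd"
    and "0 \<le> \<mu>" "0 < M"
    and mono: "rel_strongly_monotone Q V \<mu> g"
    and zs: "zs \<in> Q" and strong: "\<And>x. x \<in> Q \<Longrightarrow> 0 \<le> g zs \<bullet> (x - zs)"
    and step: "trial_step Q V g \<mu> M z w z'" and acc: "step_accepted V g M z w z'"
  shows "V zs z' \<le> inverse (1 + \<mu> / M) * V zs z"
proof -
  note wQ = trial_step_mem[OF step]
  have nonneg: "0 \<le> V u v" if "u \<in> Q" "v \<in> Q" for u v
    unfolding V using Q d that by (intro bregman_nonneg)
  have "is_arg_min (\<lambda>u. ((1 / M) *\<^sub>R g z) \<bullet> u + 1 * V u z + 0 * V u z) (\<lambda>u. u \<in> Q) w"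
    and "is_arg_min (\<lambda>u. ((1 / M) *\<^sub>R g w) \<bullet> u + 1 * V u z + (\<mu> / M) * V u w) (\<lambda>u. u \<in> Q) z'"
    using step by (simp_all add: trial_step_def)
  from this(1)[THEN bregman_prox_optimality[OF Q d V], OF wQ(2)]
    this(2)[THEN bregman_prox_optimality[OF Q d V], OF zs]
  have "g z \<bullet> (w - z') / M \<le> V z' z - V z' w - V w z"
    and "g w \<bullet> (z' - zs) / M
      \<le> (V zs z - V zs z' - V z' z) + \<mu> / M * (V zs w - V zs z' - V z' w)"
    by simp_all
  then have opt: "g z \<bullet> (w - z') \<le> M * (V z' z - V z' w - V w z)"
    "g w \<bullet> (z' - zs) \<le> M * (V zs z - V zs z' - V z' z) + \<mu> * (V zs w - V zs z' - V z' w)"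
    using \<open>0 < M\<close> by (simp_all add: field_simps)
  have "g w \<bullet> (w - zs) = g z \<bullet> (w - z') + g w \<bullet> (z' - zs) + (g z - g w) \<bullet> (z' - w)"
    by (simp add: inner_diff_left inner_diff_right)
  also have "\<dots> \<le> M * V zs z - (M + \<mu>) * V zs z' + \<mu> * V zs w - \<mu> * V z' w"
    using opt acc unfolding step_accepted_def by (simp add: algebra_simps)
  finally have upper: "g w \<bullet> (w - zs)
    \<le> M * V zs z - (M + \<mu>) * V zs z' + \<mu> * V zs w - \<mu> * V z' w" .
  have "\<mu> * V w zs + \<mu> * V zs w \<le> (g w - g zs) \<bullet> (w - zs)"
    using mono zs wQ by (simp add: rel_strongly_monotone_def)
  moreover have "0 \<le> \<mu> * V w zs" "0 \<le> \<mu> * V z' w"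
    using nonneg zs wQ \<open>0 \<le> \<mu>\<close> by simp_all
  ultimately have "(M + \<mu>) * V zs z' \<le> M * V zs z"
    using upper strong[OF wQ(1)] by (simp add: inner_diff_left)
  moreover have "inverse (1 + \<mu> / M) = M / (M + \<mu>)"
    using \<open>0 < M\<close> \<open>0 \<le> \<mu>\<close> by (simp add: field_simps)
  ultimately show ?thesis
    using \<open>0 < M\<close> \<open>0 \<le> \<mu>\<close> by (simp add: pos_le_divide_eq mult.commute)
qed

lemma large_parameter_accepted:
  fixes Q :: "'a::real_inner set"
  assumes "convex Q" "prox_function Q d nd"
    and V: "V = bregman d nd"
    and smooth: "rel_smooth Q V L g" and "L \<le> M"
    and z: "z \<in> Q" and step: "trial_step Q V g \<mu> M z w z'"
  shows "step_accepted V g M z w z'"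
proof -
  note wQ = trial_step_mem[OF step]
  have "0 \<le> V w z + V z' w"
    unfolding V using assms wQ by (intro add_nonneg_nonneg bregman_nonneg)
  with \<open>L \<le> M\<close> have "L * (V w z + V z' w) \<le> M * (V w z + V z' w)"
    by (rule mult_right_mono)
  moreover have "(g z - g w) \<bullet> (z' - w) \<le> L * V z' w + L * V w z"
    using smooth z wQ by (simp add: rel_smooth_def)
  ultimately show ?thesis
    by (simp add: step_accepted_def distrib_left)
qed

theorem mainTheorem1:
  fixes Q :: "(real ^ 'n) set"
    and d :: "real ^ 'n \<Rightarrow> real"
    and nd g :: "real ^ 'n \<Rightarrow> real ^ 'n"
    and V :: "real ^ 'n \<Rightarrow> real ^ 'n \<Rightarrow> real"
    and \<mu> L L0 :: real
    and zs :: "real ^ 'n"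
    and z w :: "nat \<Rightarrow> real ^ 'n"
    and Ls :: "nat \<Rightarrow> real"
  assumes "closed Q" and "convex Q"
    and "prox_function Q d nd"
    and V_def: "V = bregman d nd"
    and "\<mu> > 0" and "rel_strongly_monotone Q V \<mu> g"
    and "L > 0" and "rel_smooth Q V L g"
    and "vi_weak_solution Q g zs"
    and "L0 > 0"
    and "adaptive_method Q d V g \<mu> L0 z w Ls"
  shows "(\<forall>k. V zs (z (Suc k)) \<le> (\<Prod>i=0..k. inverse (1 + \<mu> / Ls (Suc i))) * V zs (z 0)) \<and>
         (L0 \<le> 2 * L \<longrightarrow>
           (\<forall>k. V zs (z (Suc k)) \<le> inverse (1 + \<mu> / (2 * L)) ^ Suc k * V zs (z 0)))"
proof -
  note Q = \<open>convex Q\<close> and d = \<open>prox_function Q d nd\<close>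
  have z0: "z 0 \<in> Q" and L0: "Ls 0 = L0"
    and iter: "\<And>k. \<exists>i wt zt.
        (\<forall>j\<le>i. trial_step Q V g \<mu> (2 powi (int j - 1) * Ls k) (z k) (wt j) (zt j)) \<and>
        step_accepted V g (2 powi (int i - 1) * Ls k) (z k) (wt i) (zt i) \<and>
        (\<forall>j<i. \<not> step_accepted V g (2 powi (int j - 1) * Ls k) (z k) (wt j) (zt j)) \<and>
        Ls (Suc k) = 2 powi (int i - 1) * Ls k \<and> w k = wt i \<and> z (Suc k) = zt i"
    using \<open>adaptive_method Q d V g \<mu> L0 z w Ls\<close>
    unfolding adaptive_method_def by (auto simp: is_arg_min_def)
  have step: "trial_step Q V g \<mu> (Ls (Suc k)) (z k) (w k) (z (Suc k))"
    and acc: "step_accepted V g (Ls (Suc k)) (z k) (w k) (z (Suc k))" for k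
    using iter[of k] by auto
  have zQ: "z k \<in> Q" for k
    using z0 trial_step_mem(2)[OF step] by (cases k) auto
  have Lpos: "0 < Ls k" for k
  proof (induction k)
    case 0
    show ?case
      using L0 \<open>L0 > 0\<close> by simp
  next
    case (Suc k)
    then show ?case
      using iter[of k] by auto
  qed
  have zs: "zs \<in> Q"
    using \<open>vi_weak_solution Q g zs\<close> by (simp add: vi_weak_solution_def)
  have strong: "0 \<le> g zs \<bullet> (x - zs)" if "x \<in> Q" for x
    using \<open>L > 0\<close> \<open>rel_smooth Q V L g\<close> \<open>vi_weak_solution Q g zs\<close> that
    by (intro weak_solution_imp_strong[OF Q d V_def]) auto
  have contract: "V zs (z (Suc k)) \<le> inverse (1 + \<mu> / Ls (Suc k)) * V zs (z k)" for k
    using \<open>\<mu> > 0\<close> Lpos \<open>rel_strongly_monotone Q V \<mu> g\<close> zs strong step acc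
    by (intro accepted_step_contracts[OF Q d V_def]) auto
  have nonneg: "0 \<le> V zs (z k)" for k
    unfolding V_def by (rule bregman_nonneg[OF Q d zQ zs])
  have adaptive: "V zs (z (Suc k)) \<le> (\<Prod>i=0..k. inverse (1 + \<mu> / Ls (Suc i))) * V zs (z 0)" for k
  proof (induction k)
    case 0
    show ?case
      using contract[of 0] by simp
  next
    case (Suc k)
    let ?q = "inverse (1 + \<mu> / Ls (Suc (Suc k)))"
    have "0 \<le> ?q"
      using \<open>\<mu> > 0\<close> Lpos[of "Suc (Suc k)"] by simp
    with Suc.IH have "?q * V zs (z (Suc k))
        \<le> ?q * ((\<Prod>i=0..k. inverse (1 + \<mu> / Ls (Suc i))) * V zs (z 0))"
      by (rule mult_left_mono)
    with contract[of "Suc k"] show ?case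
      unfolding prod.atLeast0_atMost_Suc by (simp add: ac_simps)
  qed
  have rate: "V zs (z (Suc k)) \<le> inverse (1 + \<mu> / (2 * L)) ^ Suc k * V zs (z 0)"
    if "L0 \<le> 2 * L" for k
  proof -
    have Lbound: "Ls k \<le> 2 * L" for k
    proof (induction k)
      case 0
      show ?case
        using L0 that by simp
    next
      case (Suc k)
      obtain i wt zt where
        tr: "\<forall>j\<le>i. trial_step Q V g \<mu> (2 powi (int j - 1) * Ls k) (z k) (wt j) (zt j)"
        and rej: "\<forall>j<i. \<not> step_accepted V g (2 powi (int j - 1) * Ls k) (z k) (wt j) (zt j)"
        and Lk: "Ls (Suc k) = 2 powi (int i - 1) * Ls k"
        using iter[of k] by blast
      show ?case
      proof (cases i)
        case 0
        then show ?thesis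
          using Lk Suc.IH Lpos[of k] by (simp add: power_int_minus)
      next
        case (Suc j)
        \<comment> \<open>The last rejected trial used half of the accepted parameter.\<close>
        have "Ls (Suc k) = 2 * (2 powi (int j - 1) * Ls k)"
          using Lk Suc by (simp add: power_int_diff)
        moreover have "2 powi (int j - 1) * Ls k < L"
        proof (rule ccontr)
          assume "\<not> ?thesis"
          then have "L \<le> 2 powi (int j - 1) * Ls k"
            by simp
          moreover have "trial_step Q V g \<mu> (2 powi (int j - 1) * Ls k) (z k) (wt j) (zt j)"
            using tr Suc by simp
          ultimately have "step_accepted V g (2 powi (int j - 1) * Ls k) (z k) (wt j) (zt j)"
            by (rule large_parameter_accepted[OF Q d V_def \<open>rel_smooth Q V L g\<close> _ zQ])
          then show False
            using rej Suc by simp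
        qed
        ultimately show ?thesis
          by simp
      qed
    qed
    let ?P = "\<Prod>i=0..k. inverse (1 + \<mu> / Ls (Suc i))"
    have "?P \<le> (\<Prod>i=0..k. inverse (1 + \<mu> / (2 * L)))"
    proof (intro prod_mono conjI)
      fix i
      show "0 \<le> inverse (1 + \<mu> / Ls (Suc i))"
        using \<open>\<mu> > 0\<close> Lpos[of "Suc i"] by simp
      have "\<mu> / (2 * L) \<le> \<mu> / Ls (Suc i)"
        using \<open>\<mu> > 0\<close> \<open>L > 0\<close> Lpos Lbound by (intro divide_left_mono) auto
      then show "inverse (1 + \<mu> / Ls (Suc i)) \<le> inverse (1 + \<mu> / (2 * L))"
        using \<open>\<mu> > 0\<close> \<open>L > 0\<close> by (intro le_imp_inverse_le) (auto intro: add_pos_pos)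
    qed
    also have "\<dots> = inverse (1 + \<mu> / (2 * L)) ^ Suc k"
      by simp
    finally have "?P * V zs (z 0) \<le> inverse (1 + \<mu> / (2 * L)) ^ Suc k * V zs (z 0)"
      using nonneg by (rule mult_right_mono)
    with adaptive[of k] show ?thesis
      by (rule order_trans)
  qed
  show ?thesis
    using adaptive rate by blast
qed

end
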